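(* Let $\{\phi_i,T_i,\alpha_i\}_{i=1}^r$ be the Orthogonal Nonlinear Spectral decomposition (OrthoNS) of $f\in\mathbb{R}^M$ with respect to a homogeneous operator $P$, and let $\hat f=\sum_{i=1}^r\alpha_i\phi_i$. Then OrthoNS admits Parseval's identity with respect to $\hat f$: $$\|\hat f\|^2=\sum_{i=1}^r\alpha_i^2 .$$
   Context: $\mathbb{R}^M$ carries the Euclidean norm. $P:\mathbb{R}^M\to\mathbb{R}^M$ is $(p-1)$-homogeneous, $P(c\psi)=c|c|^{p-2}P(\psi)$ for $c\in\mathbb{R}$, and $P=-\partial_\psi R$ for an absolutely $p$-homogeneous functional $R$. OrthoNS is defined as follows. Step 1 (data). Either evolve $\psi_{k+1}=\psi_k+P(\psi_k)dt_k$, $\psi_0=f$, with $dt_k=-\frac{\langle P(\psi_k),\psi_k\rangle}{\|P(\psi_k)\|^2}\delta$, $\delta\in(0,2)$ (or sample the flow $\psi_t=P(\psi)$, $\psi(0)=f$, with these step sizes); or, if a data sequence $\{\psi_k\}$ is given beforehand (posterior version), assign to $\psi_k$ the rescaled time $\tilde t_k=\sum_{i=0}^{k-1}\tilde{dt}_i$, where $\tilde{dt}_i=-\frac{\|P(\psi_i)\|^2}{\langle P(\psi_i),\psi_i\rangle}dt_i$ if $P$ and the original time steps $dt_i$ are known and $\tilde{dt}_i=-\frac{\|\psi_{i+1}-\psi_i\|^2}{\langle\psi_{i+1}-\psi_i,\psi_i\rangle}$ otherwise, and interpolate the data in $\tilde t$ and resample with a fixed step size. This gives a sequence of snapshots,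 again denoted $\psi_0,\dots,\psi_N\in\mathbb{R}^M$. Step 2 (symmetric DMD of dimensionality $r$). Put $\Psi_0^{N-1}=[\psi_0\ \cdots\ \psi_{N-1}]$, $\Psi_1^N=[\psi_1\ \cdots\ \psi_N]$; let $\Psi_0^{N-1}=U\Sigma V^*$ be a (real) singular value decomposition and $U_r$ the first $r$ columns of $U$ (so $U_r^*U_r=I$); put $X=U_r^*\Psi_0^{N-1}$, $Y=U_r^*\Psi_1^N$. Let $F$ be the real symmetric $r\times r$ matrix minimizing the Frobenius norm $\|Y-FX\|_{\mathcal F}^2$ among symmetric matrices, i.e. the solution of $FXX^T+XX^TF=XY^T+YX^T$. Let $\mu_i$ be the eigenvalues of $F$ and $w_1,\dots,w_r\in\mathbb{R}^r$ a corresponding orthonormal set of eigenvectors. The modes are $\phi_i=U_rw_i$ and the coefficients are $\alpha_i=w_i^*U_r^*\psi_0$. Step 3 (nonlinear eigenvalues). To each mode a nonlinear eigenvalue $\lambda_i$ is associated, either by $\lambda_i=\frac{1-\mu_i}{\delta}\frac{\|P(\phi_i)\|^2}{\langle P(\phi_i),\phi_i\rangle}$ or by $\lambda_i=\frac{\sum_{k=0}^N\mu_i^{k(2-p)}t_k-\sum_{k=0}^Nt_k}{(2-p)\sum_{k=0}^Nt_k^2}$ (where $t_k$ is the time of the $k$-th snapshot), and $T_i=-\frac{1}{\lambda_i(2-p)}$ is its extinction time. The OrthoNS of $f$ and $P$ is the set $\{\phi_i,T_i,\alpha_i\}_{i=1}^r$. *)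

theory Defs
  imports Complex_Main "Jordan_Normal_Form.Matrix" "Jordan_Normal_Form.Char_Poly"
begin

text \<open>
  The space \<open>\<real>\<^sup>M\<close> is \<^term>\<open>carrier_vec M :: real vec set\<close>. Indices of modes run over
  \<open>0, \<dots>, r - 1\<close>. Denominators are never assumed to be nonzero; where one
  vanishes, the convention \<open>x / 0 = 0\<close> applies.
\<close>

definition l2_norm :: "real vec \<Rightarrow> real" where
  "l2_norm v = sqrt (v \<bullet> v)"

definition frobenius_norm :: "real mat \<Rightarrow> real" where
  "frobenius_norm A = sqrt (\<Sum>i<dim_row A. \<Sum>j<dim_col A. (A $$ (i, j))\<^sup>2)"


subsection \<open>The operator and its functional\<close>

definition homogeneous_op :: "nat \<Rightarrow> real \<Rightarrow> (real vec \<Rightarrow> real vec) \<Rightarrow> bool" where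
  "homogeneous_op M p P \<longleftrightarrow>
     (\<forall>\<psi>\<in>carrier_vec M. P \<psi> \<in> carrier_vec M \<and>
        (\<forall>c. P (c \<cdot>\<^sub>v \<psi>) = (c * \<bar>c\<bar> powr (p - 2)) \<cdot>\<^sub>v P \<psi>))"

definition abs_homogeneous :: "nat \<Rightarrow> real \<Rightarrow> (real vec \<Rightarrow> real) \<Rightarrow> bool" where
  "abs_homogeneous M p R \<longleftrightarrow>
     (\<forall>\<psi>\<in>carrier_vec M. \<forall>c. R (c \<cdot>\<^sub>v \<psi>) = \<bar>c\<bar> powr p * R \<psi>)"

definition is_gradient :: "nat \<Rightarrow> (real vec \<Rightarrow> real) \<Rightarrow> real vec \<Rightarrow> real vec \<Rightarrow> bool" where
  "is_gradient M R \<psi> g \<longleftrightarrow>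
     (\<forall>h\<in>carrier_vec M. ((\<lambda>s. R (\<psi> + s \<cdot>\<^sub>v h)) has_real_derivative (g \<bullet> h)) (at 0))"

definition is_subgradient :: "nat \<Rightarrow> (real vec \<Rightarrow> real) \<Rightarrow> real vec \<Rightarrow> real vec \<Rightarrow> bool" where
  "is_subgradient M R \<psi> g \<longleftrightarrow> (\<forall>\<chi>\<in>carrier_vec M. R \<psi> + g \<bullet> (\<chi> - \<psi>) \<le> R \<chi>)"

text \<open>
  \<open>P = - \<partial>R\<close>. The subgradient alternative covers nonsmooth \<open>R\<close>: an absolutely
  1-homogeneous functional has a gradient at the origin only if it vanishes identically.
\<close>

definition neg_gradient_of :: "nat \<Rightarrow> (real vec \<Rightarrow> real) \<Rightarrow> (real vec \<Rightarrow> real vec) \<Rightarrow> bool" where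
  "neg_gradient_of M R P \<longleftrightarrow>
     (\<forall>\<psi>\<in>carrier_vec M. is_gradient M R \<psi> (- P \<psi>) \<or> is_subgradient M R \<psi> (- P \<psi>))"


subsection \<open>Snapshots\<close>

text \<open>
  In the following, \<open>\<psi> k\<close> and \<open>t k\<close> (for \<open>k \<le> N\<close>) are the snapshots and their times.
\<close>

definition adaptive_step :: "(real vec \<Rightarrow> real vec) \<Rightarrow> real \<Rightarrow> real vec \<Rightarrow> real" where
  "adaptive_step P \<delta> v = - ((P v \<bullet> v) / (l2_norm (P v))\<^sup>2) * \<delta>"

definition evolved_snapshots ::
  "(real vec \<Rightarrow> real vec) \<Rightarrow> real \<Rightarrow> real vec \<Rightarrow> nat \<Rightarrow> (nat \<Rightarrow> real vec) \<Rightarrow> (nat \<Rightarrow> real) \<Rightarrow> bool" where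
  "evolved_snapshots P \<delta> f N \<psi> t \<longleftrightarrow>
     \<psi> 0 = f \<and> t 0 = 0 \<and>
     (\<forall>k<N. \<psi> (Suc k) = \<psi> k + adaptive_step P \<delta> (\<psi> k) \<cdot>\<^sub>v P (\<psi> k) \<and>
            t (Suc k) = t k + adaptive_step P \<delta> (\<psi> k))"

text \<open>
  Continuity together with the equation for the right derivative is the ordinary notion of a
  solution when \<open>P\<close> is continuous; it also admits the kinks of nonsmooth gradient flows.
\<close>

definition flow_solution ::
  "nat \<Rightarrow> (real vec \<Rightarrow> real vec) \<Rightarrow> real vec \<Rightarrow> real \<Rightarrow> (real \<Rightarrow> real vec) \<Rightarrow> bool" where
  "flow_solution M P f \<tau> x \<longleftrightarrow>
     x 0 = f \<and> (\<forall>s\<in>{0..\<tau>}. x s \<in> carrier_vec M) \<and>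
     (\<forall>i<M. continuous_on {0..\<tau>} (\<lambda>s. x s $ i) \<and>
        (\<forall>s\<in>{0..<\<tau>}. ((\<lambda>u. x u $ i) has_real_derivative (P (x s) $ i)) (at_right s)))"

definition sampled_snapshots ::
  "nat \<Rightarrow> (real vec \<Rightarrow> real vec) \<Rightarrow> real \<Rightarrow> real vec \<Rightarrow> nat \<Rightarrow> (nat \<Rightarrow> real vec) \<Rightarrow> (nat \<Rightarrow> real) \<Rightarrow> bool" where
  "sampled_snapshots M P \<delta> f N \<psi> t \<longleftrightarrow>
     (\<exists>\<tau> x. flow_solution M P f \<tau> x \<and>
        t 0 = 0 \<and> (\<forall>k<N. t (Suc k) = t k + adaptive_step P \<delta> (\<psi> k)) \<and>
        (\<forall>k\<le>N. t k \<in> {0..\<tau>} \<and> \<psi> k = x (t k)))"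

text \<open>
  The rescaled step between \<open>g i\<close> and \<open>g (i + 1)\<close>; \<open>Some dt\<close> means that \<open>P\<close> and the
  original time steps \<open>dt\<close> are known.
\<close>

definition rescaled_step ::
  "(real vec \<Rightarrow> real vec) \<Rightarrow> (nat \<Rightarrow> real) option \<Rightarrow> (nat \<Rightarrow> real vec) \<Rightarrow> nat \<Rightarrow> real" where
  "rescaled_step P dts g i =
     (case dts of
        Some dt \<Rightarrow> - ((l2_norm (P (g i)))\<^sup>2 / (P (g i) \<bullet> g i)) * dt i
      | None \<Rightarrow> - ((l2_norm (g (Suc i) - g i))\<^sup>2 / ((g (Suc i) - g i) \<bullet> g i)))"

definition rescaled_time ::
  "(real vec \<Rightarrow> real vec) \<Rightarrow> (nat \<Rightarrow> real) option \<Rightarrow> (nat \<Rightarrow> real vec) \<Rightarrow> nat \<Rightarrow> real" where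
  "rescaled_time P dts g k = (\<Sum>i<k. rescaled_step P dts g i)"

text \<open>
  The interpolation scheme is left open: \<open>x\<close> is any function of the rescaled time through the
  data. A step of size \<open>\<delta>\<close> in rescaled time is one step of size
  \<^term>\<open>adaptive_step P \<delta>\<close> in original time, so the fixed resampling step plays the
  role of \<open>\<delta>\<close>. The times of the resampled snapshots are their rescaled times.
\<close>

definition resampled_snapshots ::
  "nat \<Rightarrow> (real vec \<Rightarrow> real vec) \<Rightarrow> real \<Rightarrow> real vec \<Rightarrow> nat \<Rightarrow> (nat \<Rightarrow> real vec) \<Rightarrow> (nat \<Rightarrow> real) \<Rightarrow> bool" where
  "resampled_snapshots M P \<delta> f N \<psi> t \<longleftrightarrow>
     (\<exists>K g dts x.
        (\<forall>k\<le>K. g k \<in> carrier_vec M) \<and> g 0 = f \<and>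
        (\<forall>s. x s \<in> carrier_vec M) \<and>
        (\<forall>k\<le>K. x (rescaled_time P dts g k) = g k) \<and>
        (\<forall>k\<le>N. t k = real k * \<delta> \<and> t k \<le> rescaled_time P dts g K \<and> \<psi> k = x (t k)))"

definition orthons_data ::
  "nat \<Rightarrow> (real vec \<Rightarrow> real vec) \<Rightarrow> real \<Rightarrow> real vec \<Rightarrow> nat \<Rightarrow> (nat \<Rightarrow> real vec) \<Rightarrow> (nat \<Rightarrow> real) \<Rightarrow> bool" where
  "orthons_data M P \<delta> f N \<psi> t \<longleftrightarrow>
     (\<delta> \<in> {0<..<2} \<and> (evolved_snapshots P \<delta> f N \<psi> t \<or> sampled_snapshots M P \<delta> f N \<psi> t))
     \<or> (\<delta> > 0 \<and> resampled_snapshots M P \<delta> f N \<psi> t)"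


subsection \<open>Symmetric DMD\<close>

definition is_svd :: "real mat \<Rightarrow> real mat \<Rightarrow> real mat \<Rightarrow> real mat \<Rightarrow> bool" where
  "is_svd A U S V \<longleftrightarrow>
     U \<in> carrier_mat (dim_row A) (dim_row A) \<and> U\<^sup>T * U = 1\<^sub>m (dim_row A) \<and>
     V \<in> carrier_mat (dim_col A) (dim_col A) \<and> V\<^sup>T * V = 1\<^sub>m (dim_col A) \<and>
     S \<in> carrier_mat (dim_row A) (dim_col A) \<and> diagonal_mat S \<and>
     (\<forall>i < min (dim_row A) (dim_col A). 0 \<le> S $$ (i, i)) \<and>
     (\<forall>j < min (dim_row A) (dim_col A). \<forall>i\<le>j. S $$ (j, j) \<le> S $$ (i, i)) \<and>
     A = U * S * V\<^sup>T"

definition first_cols :: "nat \<Rightarrow> real mat \<Rightarrow> real mat" where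
  "first_cols r A = mat_of_cols (dim_row A) (take r (cols A))"

definition symmetric_mat :: "real mat \<Rightarrow> bool" where
  "symmetric_mat A \<longleftrightarrow> A\<^sup>T = A"

definition is_symmetric_dmd_matrix :: "nat \<Rightarrow> real mat \<Rightarrow> real mat \<Rightarrow> real mat \<Rightarrow> bool" where
  "is_symmetric_dmd_matrix r X Y F \<longleftrightarrow>
     F \<in> carrier_mat r r \<and> symmetric_mat F \<and>
     (\<forall>G\<in>carrier_mat r r. symmetric_mat G \<longrightarrow>
        (frobenius_norm (Y - F * X))\<^sup>2 \<le> (frobenius_norm (Y - G * X))\<^sup>2)"

definition symmetric_dmd ::
  "nat \<Rightarrow> nat \<Rightarrow> nat \<Rightarrow> (nat \<Rightarrow> real vec) \<Rightarrow>
   (nat \<Rightarrow> real vec) \<Rightarrow> (nat \<Rightarrow> real) \<Rightarrow> (nat \<Rightarrow> real) \<Rightarrow> bool" where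
  "symmetric_dmd M N r \<psi> \<phi> \<mu> \<alpha> \<longleftrightarrow>
     r \<le> M \<and>
     (\<exists>U S V F w.
        let \<Psi>\<^sub>0 = mat_of_cols M (map \<psi> [0..<N]);
            \<Psi>\<^sub>1 = mat_of_cols M (map \<psi> [1..<Suc N]);
            U\<^sub>r = first_cols r U
        in is_svd \<Psi>\<^sub>0 U S V \<and>
           is_symmetric_dmd_matrix r (U\<^sub>r\<^sup>T * \<Psi>\<^sub>0) (U\<^sub>r\<^sup>T * \<Psi>\<^sub>1) F \<and>
           (\<forall>i<r. eigenvector F (w i) (\<mu> i)) \<and>
           (\<forall>i<r. \<forall>j<r. w i \<bullet> w j = (if i = j then 1 else 0)) \<and>
           (\<forall>i<r. \<phi> i = U\<^sub>r *\<^sub>v w i) \<and>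
           (\<forall>i<r. \<alpha> i = w i \<bullet> (U\<^sub>r\<^sup>T *\<^sub>v \<psi> 0)))"


subsection \<open>Nonlinear eigenvalues and the decomposition\<close>

definition rayleigh_eigenvalue :: "(real vec \<Rightarrow> real vec) \<Rightarrow> real \<Rightarrow> real vec \<Rightarrow> real \<Rightarrow> real" where
  "rayleigh_eigenvalue P \<delta> \<phi> \<mu> = (1 - \<mu>) / \<delta> * ((l2_norm (P \<phi>))\<^sup>2 / (P \<phi> \<bullet> \<phi>))"

text \<open>
  The power \<open>\<mu>\<close> to the \<open>k (2 - p)\<close> is written as \<open>(\<mu> ^ k) powr (2 - p)\<close>, which equals 1
  for \<open>k = 0\<close> also if \<open>\<mu> = 0\<close> (note that \<open>0 powr 0 = 0\<close>).
\<close>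

definition fitted_eigenvalue :: "real \<Rightarrow> nat \<Rightarrow> (nat \<Rightarrow> real) \<Rightarrow> real \<Rightarrow> real" where
  "fitted_eigenvalue p N t \<mu> =
     ((\<Sum>k=0..N. (\<mu> ^ k) powr (2 - p) * t k) - (\<Sum>k=0..N. t k))
     / ((2 - p) * (\<Sum>k=0..N. (t k)\<^sup>2))"

definition OrthoNS ::
  "nat \<Rightarrow> nat \<Rightarrow> real \<Rightarrow> (real vec \<Rightarrow> real vec) \<Rightarrow> real vec \<Rightarrow>
   (nat \<Rightarrow> real vec) \<Rightarrow> (nat \<Rightarrow> real) \<Rightarrow> (nat \<Rightarrow> real) \<Rightarrow> bool" where
  "OrthoNS M r p P f \<phi> T \<alpha> \<longleftrightarrow>
     (\<exists>N \<delta> \<psi> t \<mu> \<Lambda>.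
        0 < N \<and> orthons_data M P \<delta> f N \<psi> t \<and>
        symmetric_dmd M N r \<psi> \<phi> \<mu> \<alpha> \<and>
        (\<forall>i<r. \<Lambda> i = rayleigh_eigenvalue P \<delta> (\<phi> i) (\<mu> i) \<or>
               \<Lambda> i = fitted_eigenvalue p N t (\<mu> i)) \<and>
        (\<forall>i<r. T i = - 1 / (\<Lambda> i * (2 - p))))"

end

theory Submission
  imports Defs "Jordan_Normal_Form.VS_Connect"
begin

text \<open>The modes form an orthonormal family in \<real>^M, and the identity is then Pythagoras
  for a linear combination of orthonormal vectors (\<open>orthonormal_norm_sq\<close>, valid for
  arbitrary coefficients). Orthonormality has two sources: the vectors \<open>w i\<close> are
  orthonormal in \<real>^r, and the leading r left singular vectors are orthonormal columns
  (\<open>first_cols_orthonormal\<close>), so multiplication by them is an isometry from \<real>^r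
  into \<real>^M (\<open>isometry_scalar_prod\<close>) and carries the \<open>w i\<close> to
  orthonormal modes.\<close>

lemma finsum_vec_scalar_prod:
  fixes u :: "'b \<Rightarrow> 'a :: field vec"
  assumes "\<And>k. k \<in> I \<Longrightarrow> u k \<in> carrier_vec n" "v \<in> carrier_vec n"
  shows "finsum_vec TYPE('a) n u I \<bullet> v = (\<Sum>k\<in>I. u k \<bullet> v)"
  using assms vec_space.finsum_scalar_prod_sum[of u I n v] by (simp add: vec_space.finsum_vec Pi_def)

lemma orthonormal_norm_sq:
  fixes u :: "'b \<Rightarrow> real vec"
  assumes "finite I" and u: "\<And>i. i \<in> I \<Longrightarrow> u i \<in> carrier_vec n"
    and on: "\<And>i j. i \<in> I \<Longrightarrow> j \<in> I \<Longrightarrow> u i \<bullet> u j = (if i = j then 1 else 0)"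
  shows "(l2_norm (finsum_vec TYPE(real) n (\<lambda>i. a i \<cdot>\<^sub>v u i) I))\<^sup>2 = (\<Sum>i\<in>I. (a i)\<^sup>2)"
proof -
  let ?s = "finsum_vec TYPE(real) n (\<lambda>i. a i \<cdot>\<^sub>v u i) I"
  have s: "?s \<in> carrier_vec n" using u by (intro finsum_vec_closed) auto
  \<comment> \<open>Pairing with \<open>u j\<close> recovers the j-th coefficient. Expanding only
    the left factor of \<open>?s \<bullet> ?s\<close> afterwards then avoids a double sum.\<close>
  have c: "?s \<bullet> u j = a j" if "j \<in> I" for j
  proof -
    have "?s \<bullet> u j = (\<Sum>k\<in>I. (a k \<cdot>\<^sub>v u k) \<bullet> u j)"
      using u that \<open>finite I\<close> by (intro finsum_vec_scalar_prod) auto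
    also have "\<dots> = (\<Sum>k\<in>I. if k = j then a k else 0)"
      using u that by (intro sum.cong) (auto simp: on smult_scalar_prod_distrib[of _ n])
    finally show ?thesis using that \<open>finite I\<close> by simp
  qed
  have "?s \<bullet> ?s = (\<Sum>k\<in>I. (a k \<cdot>\<^sub>v u k) \<bullet> ?s)"
    using u s \<open>finite I\<close> by (intro finsum_vec_scalar_prod) auto
  also have "\<dots> = (\<Sum>k\<in>I. (a k)\<^sup>2)"
    using u s c
    by (intro sum.cong)
       (auto simp: smult_scalar_prod_distrib[of _ n] comm_scalar_prod[of _ n ?s] power2_eq_square)
  \<comment> \<open>The radicand equals a sum of squares, hence is nonnegative, so squaring cancels
    the root in \<open>l2_norm\<close>.\<close>
  finally show ?thesis by (simp add: l2_norm_def sum_nonneg)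
qed

text \<open>The Gram matrix of the first r columns is the leading r by r block of the Gram matrix of
  all columns. The bound \<open>r \<le> m\<close> ensures that \<open>take\<close> really yields r
  columns.\<close>

lemma first_cols_orthonormal:
  assumes "U \<in> carrier_mat n m" "U\<^sup>T * U = 1\<^sub>m m" "r \<le> m"
  shows "(first_cols r U)\<^sup>T * first_cols r U = 1\<^sub>m r"
proof (rule eq_matI)
  have col: "col (first_cols r U) i = col U i" if "i < r" for i
    unfolding first_cols_def using assms(1,3) that by (subst col_mat_of_cols) auto
  fix i j assume ij: "i < dim_row (1\<^sub>m r :: real mat)" "j < dim_col (1\<^sub>m r :: real mat)"
  then have "(U\<^sup>T * U) $$ (i, j) = (1\<^sub>m m :: real mat) $$ (i, j)" using assms by simp
  with ij assms(1,3) show "((first_cols r U)\<^sup>T * first_cols r U) $$ (i, j) = 1\<^sub>m r $$ (i, j)"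
    using col[of i] col[of j] by (simp add: first_cols_def)
qed (use assms in \<open>simp_all add: first_cols_def\<close>)

text \<open>Moving one factor \<open>A\<close> across the scalar product as its transpose produces
  the Gram matrix, which is the identity.\<close>

lemma isometry_scalar_prod:
  fixes A :: "'a :: comm_ring_1 mat"
  assumes A: "A \<in> carrier_mat n r" "A\<^sup>T * A = 1\<^sub>m r"
    and x: "x \<in> carrier_vec r" and y: "y \<in> carrier_vec r"
  shows "(A *\<^sub>v x) \<bullet> (A *\<^sub>v y) = x \<bullet> y"
proof -
  have "(A *\<^sub>v x) \<bullet> (A *\<^sub>v y) = (A\<^sup>T *\<^sub>v (A *\<^sub>v x)) \<bullet> y"
    using transpose_vec_mult_scalar[OF A(1) y, of "A *\<^sub>v x"] A x by simp
  also have "A\<^sup>T *\<^sub>v (A *\<^sub>v x) = (A\<^sup>T * A) *\<^sub>v x"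
    using A(1) x by (intro assoc_mult_mat_vec[symmetric, of _ r n _ r]) auto
  finally show ?thesis using A(2) x by simp
qed

lemma symmetric_dmd_modes_orthonormal:
  assumes "symmetric_dmd M N r \<psi> \<phi> \<mu> \<alpha>"
  shows "\<forall>i<r. \<phi> i \<in> carrier_vec M"
    and "\<forall>i<r. \<forall>j<r. \<phi> i \<bullet> \<phi> j = (if i = j then 1 else 0)"
proof -
  obtain U S V F w where r: "r \<le> M"
    and svd: "is_svd (mat_of_cols M (map \<psi> [0..<N])) U S V"
    and F: "F \<in> carrier_mat r r"
    and ev: "\<And>i. i < r \<Longrightarrow> eigenvector F (w i) (\<mu> i)"
    and on: "\<And>i j. i < r \<Longrightarrow> j < r \<Longrightarrow> w i \<bullet> w j = (if i = j then 1 else 0)"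
    and \<phi>: "\<And>i. i < r \<Longrightarrow> \<phi> i = first_cols r U *\<^sub>v w i"
    using assms unfolding symmetric_dmd_def is_symmetric_dmd_matrix_def Let_def by metis
  have U: "U \<in> carrier_mat M M" "U\<^sup>T * U = 1\<^sub>m M" using svd by (auto simp: is_svd_def)
  have A: "first_cols r U \<in> carrier_mat M r" using U(1) r by (auto simp: first_cols_def)
  \<comment> \<open>The dimension of \<open>w i\<close> is read off from \<open>eigenvector\<close>,
    which places it in the space on which \<open>F\<close> acts.\<close>
  have w: "w i \<in> carrier_vec r" if "i < r" for i
    using ev[OF that] F by (auto simp: eigenvector_def)
  show "\<forall>i<r. \<phi> i \<in> carrier_vec M" using A w \<phi> by auto
  show "\<forall>i<r. \<forall>j<r. \<phi> i \<bullet> \<phi> j = (if i = j then 1 else 0)"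
    using isometry_scalar_prod[OF A first_cols_orthonormal[OF U r]] w \<phi> on by simp
qed

theorem theorem4:
  fixes M r :: nat and p :: real
    and R :: "real vec \<Rightarrow> real" and P :: "real vec \<Rightarrow> real vec"
    and f f_hat :: "real vec" and \<phi> :: "nat \<Rightarrow> real vec" and T \<alpha> :: "nat \<Rightarrow> real"
  assumes "f \<in> carrier_vec M"
    and "homogeneous_op M p P"
    and "abs_homogeneous M p R"
    and "neg_gradient_of M R P"
    and "OrthoNS M r p P f \<phi> T \<alpha>"
    and "f_hat = finsum_vec TYPE(real) M (\<lambda>i. \<alpha> i \<cdot>\<^sub>v \<phi> i) {..<r}"
  shows "(l2_norm f_hat)\<^sup>2 = (\<Sum>i<r. (\<alpha> i)\<^sup>2)"
proof -
  obtain N \<psi> \<mu> where "symmetric_dmd M N r \<psi> \<phi> \<mu> \<alpha>"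
    using assms(5) unfolding OrthoNS_def by blast
  from symmetric_dmd_modes_orthonormal[OF this] show ?thesis
    unfolding assms(6) by (intro orthonormal_norm_sq) auto
qed

end
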